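(* Let $n\ge 1$ and let $A,B\in M_n(\mathbb{H})$. Then: (1) $w_{\mathbb{H}}(ABA^{*})\le\|A\|^2\,w_{\mathbb{H}}(B)$. In particular, if $P\in M_n(\mathbb{H})$ satisfies $P^{*}=P$ and $P^2=P$, then $w_{\mathbb{H}}(PBP)\le w_{\mathbb{H}}(B)$. (2) $w_{\mathbb{H}}\left(\begin{bmatrix}A&0\\0&B\end{bmatrix}\right)=\max\{w_{\mathbb{H}}(A),\,w_{\mathbb{H}}(B)\}$, where the block matrix is in $M_{2n}(\mathbb{H})$.
   Context: $\mathbb{H}$ denotes the real quaternions and $M_n(\mathbb{H})$ the $n\times n$ quaternionic matrices, acting on column vectors in the right quaternionic Hilbert space $\mathbb{H}^n$ from the left; $A^{*}$ is the conjugate transpose. The inner product is $\langle (p_l),(q_l)\rangle_{\mathbb{H}}=\sum_l\overline{p_l}\,q_l$, with norm $\|X\|=\langle X,X\rangle_{\mathbb{H}}^{1/2}$; $S_{\mathbb{H}^n}$ is the unit sphere. $\|A\|=\sup\{\|AX\|:X\in S_{\mathbb{H}^n}\}$ is the operator norm. The quaternionic numerical range is $W_{\mathbb{H}}(A)=\{\langle X,AX\rangle_{\mathbb{H}}:X\in S_{\mathbb{H}^n}\}$ and the quaternionic numerical radius is $w_{\mathbb{H}}(A)=\sup\{|q|:q\in W_{\mathbb{H}}(A)\}$. *)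

theory Defs
  imports "HOL-Analysis.Analysis"
begin

section \<open>The real quaternions\<close>

datatype quat = Quat (qre: real) (qi: real) (qj: real) (qk: real)

lemma quat_eq_iff: "x = y \<longleftrightarrow> qre x = qre y \<and> qi x = qi y \<and> qj x = qj y \<and> qk x = qk y"
  using quat.expand by auto

instantiation quat :: ring_1
begin

definition "0 = Quat 0 0 0 0"
definition "1 = Quat 1 0 0 0"
definition "x + y = Quat (qre x + qre y) (qi x + qi y) (qj x + qj y) (qk x + qk y)"
definition "- x = Quat (- qre x) (- qi x) (- qj x) (- qk x)"
definition "x - y = Quat (qre x - qre y) (qi x - qi y) (qj x - qj y) (qk x - qk y)"
definition "x * y = Quat
    (qre x * qre y - qi x * qi y - qj x * qj y - qk x * qk y)
    (qre x * qi y + qi x * qre y + qj x * qk y - qk x * qj y)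
    (qre x * qj y - qi x * qk y + qj x * qre y + qk x * qi y)
    (qre x * qk y + qi x * qj y - qj x * qi y + qk x * qre y)"

lemma quat_sel_simps [simp]:
  "qre 0 = 0" "qi 0 = 0" "qj 0 = 0" "qk 0 = 0"
  "qre 1 = 1" "qi 1 = 0" "qj 1 = 0" "qk 1 = 0"
  "qre (x + y) = qre x + qre y" "qi (x + y) = qi x + qi y"
  "qj (x + y) = qj x + qj y" "qk (x + y) = qk x + qk y"
  "qre (- x) = - qre x" "qi (- x) = - qi x" "qj (- x) = - qj x" "qk (- x) = - qk x"
  "qre (x - y) = qre x - qre y" "qi (x - y) = qi x - qi y"
  "qj (x - y) = qj x - qj y" "qk (x - y) = qk x - qk y"
  "qre (x * y) = qre x * qre y - qi x * qi y - qj x * qj y - qk x * qk y"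
  "qi (x * y) = qre x * qi y + qi x * qre y + qj x * qk y - qk x * qj y"
  "qj (x * y) = qre x * qj y - qi x * qk y + qj x * qre y + qk x * qi y"
  "qk (x * y) = qre x * qk y + qi x * qj y - qj x * qi y + qk x * qre y"
  by (simp_all add: zero_quat_def one_quat_def plus_quat_def uminus_quat_def
      minus_quat_def times_quat_def)

instance
  by intro_classes (simp_all add: quat_eq_iff algebra_simps)

end

instantiation quat :: real_vector
begin

definition "scaleR r x = Quat (r * qre x) (r * qi x) (r * qj x) (r * qk x)"

lemma quat_scaleR_sel [simp]:
  "qre (r *\<^sub>R x) = r * qre x" "qi (r *\<^sub>R x) = r * qi x"
  "qj (r *\<^sub>R x) = r * qj x" "qk (r *\<^sub>R x) = r * qk x"
  by (simp_all add: scaleR_quat_def)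

instance
  by intro_classes (simp_all add: quat_eq_iff algebra_simps)

end

instantiation quat :: real_inner
begin

definition "inner x y = qre x * qre y + qi x * qi y + qj x * qj y + qk x * qk y"
definition "norm x = sqrt ((qre x)\<^sup>2 + (qi x)\<^sup>2 + (qj x)\<^sup>2 + (qk x)\<^sup>2)" for x :: quat
definition "sgn x = x /\<^sub>R norm x" for x :: quat
definition "dist x y = norm (x - y)" for x y :: quat
definition uniformity_quat_def:
  "(uniformity :: (quat \<times> quat) filter) = (INF e\<in>{0<..}. principal {(x, y). dist x y < e})"
definition open_quat_def:
  "open (U :: quat set) \<longleftrightarrow> (\<forall>x\<in>U. eventually (\<lambda>(x', y). x' = x \<longrightarrow> y \<in> U) uniformity)"

instance
proof
  fix x y z :: quat and r :: real
  show "inner x y = inner y x" "inner (x + y) z = inner x z + inner y z"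
    "inner (r *\<^sub>R x) y = r * inner x y" "0 \<le> inner x x"
    by (simp_all add: inner_quat_def scaleR_quat_def algebra_simps)
  show "inner x x = 0 \<longleftrightarrow> x = 0"
    unfolding inner_quat_def quat_eq_iff quat_sel_simps
    by (smt (verit) mult_eq_0_iff not_sum_squares_lt_zero zero_le_square)
  show "norm x = sqrt (inner x x)"
    by (simp add: norm_quat_def inner_quat_def power2_eq_square)
qed (simp_all add: sgn_quat_def dist_quat_def uniformity_quat_def open_quat_def)

end

lemma norm_mult_quat: "norm (x * y) = norm x * norm y" for x y :: quat
  unfolding norm_quat_def real_sqrt_mult [symmetric]
  by (rule arg_cong [where f = sqrt]) (simp add: power2_eq_square algebra_simps)

instance quat :: real_normed_algebra_1
proof
  fix x y :: quat and r :: real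
  show "r *\<^sub>R x * y = r *\<^sub>R (x * y)" "x * r *\<^sub>R y = r *\<^sub>R (x * y)"
    by (simp_all add: quat_eq_iff algebra_simps)
  show "norm (x * y) \<le> norm x * norm y"
    by (simp add: norm_mult_quat)
  show "norm (1 :: quat) = 1"
    by (simp add: norm_quat_def)
qed

definition qcnj :: "quat \<Rightarrow> quat"
  where "qcnj x = Quat (qre x) (- qi x) (- qj x) (- qk x)"

lemma qcnj_sel [simp]:
  "qre (qcnj x) = qre x" "qi (qcnj x) = - qi x" "qj (qcnj x) = - qj x" "qk (qcnj x) = - qk x"
  by (simp_all add: qcnj_def)

lemma qcnj_mult: "qcnj (x * y) = qcnj y * qcnj x"
  by (simp add: quat_eq_iff)

lemma qcnj_mult_self: "qcnj x * x = of_real ((norm x)\<^sup>2)"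
  by (simp add: quat_eq_iff norm_quat_def of_real_def power2_eq_square)

lemma norm_qcnj [simp]: "norm (qcnj x) = norm x"
  by (simp add: norm_quat_def)


section \<open>Quaternionic matrices, numerical range and numerical radius\<close>

text \<open>
  Column vectors are of type \<^typ>\<open>quat ^ 'n\<close>. The library product \<^term>\<open>A *v X\<close> has entries
  \<open>\<Sum>j. A$i$j * X$j\<close>, i.e. the matrix acts from the left with the coefficients on the left.
\<close>

definition qinner :: "quat ^ 'n \<Rightarrow> quat ^ 'n \<Rightarrow> quat"
  where "qinner X Y = (\<Sum>l\<in>UNIV. qcnj (X $ l) * Y $ l)"

text \<open>The library norm on \<^typ>\<open>quat ^ 'n\<close> is the one induced by \<^const>\<open>qinner\<close>.\<close>

lemma qinner_self: "qinner X X = of_real ((norm X)\<^sup>2)"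
  by (simp add: qinner_def qcnj_mult_self norm_vec_def L2_set_def sum_nonneg)

lemma norm_eq_sqrt_qinner: "norm X = sqrt (qre (qinner X X))"
  unfolding qinner_self of_real_def by simp

definition qadjoint :: "quat ^ 'n ^ 'm \<Rightarrow> quat ^ 'm ^ 'n"
  where "qadjoint A = (\<chi> i j. qcnj (A $ j $ i))"

definition qopnorm :: "quat ^ 'n ^ 'n \<Rightarrow> real"
  where "qopnorm A = (SUP X\<in>sphere 0 1. norm (A *v X))"

definition qnum_range :: "quat ^ 'n ^ 'n \<Rightarrow> quat set"
  where "qnum_range A = {qinner X (A *v X) |X. X \<in> sphere 0 1}"

definition qnum_radius :: "quat ^ 'n ^ 'n \<Rightarrow> real"
  where "qnum_radius A = (SUP q\<in>qnum_range A. norm q)"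

text \<open>The block matrix with diagonal blocks \<open>A\<close>, \<open>B\<close>; the index type \<^typ>\<open>'n + 'n\<close> has \<open>2n\<close> elements.\<close>

definition qblock_diag :: "quat ^ 'n ^ 'n \<Rightarrow> quat ^ 'n ^ 'n \<Rightarrow> quat ^ ('n + 'n) ^ ('n + 'n)"
  where "qblock_diag A B = (\<chi> i j. case (i, j) of
      (Inl k, Inl l) \<Rightarrow> A $ k $ l
    | (Inr k, Inr l) \<Rightarrow> B $ k $ l
    | _ \<Rightarrow> 0)"

text \<open>
  Suprema of real sets are only meaningful for nonempty sets that are bounded above; both
  suprema above are of this kind.
\<close>

lemma qsphere_nonempty: "sphere (0 :: quat ^ 'n) 1 \<noteq> {}"
proof -
  have "norm (axis undefined 1 :: quat ^ 'n) = 1"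
    by (simp add: norm_vec_def L2_set_def axis_def if_distrib [where f = norm]
        if_distrib [where f = "\<lambda>x. x\<^sup>2"] cong: if_cong)
  then show ?thesis
    unfolding sphere_def by (auto intro!: exI [of _ "axis undefined 1"])
qed

lemma norm_qmatvec_le:
  "norm (A *v X) \<le> (\<Sum>i\<in>UNIV. \<Sum>j\<in>UNIV. norm (A $ i $ j)) * norm X"
  for A :: "quat ^ 'n ^ 'm"
proof -
  have "norm (A *v X) \<le> (\<Sum>i\<in>UNIV. norm ((A *v X) $ i))"
    by (simp add: norm_vec_def L2_set_le_sum)
  also have "\<dots> \<le> (\<Sum>i\<in>UNIV. \<Sum>j\<in>UNIV. norm (A $ i $ j) * norm X)"
    unfolding matrix_vector_mult_def
    by (auto intro!: sum_mono order_trans [OF norm_sum]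
        order_trans [OF norm_mult_ineq] mult_left_mono simp: Finite_Cartesian_Product.norm_nth_le)
  finally show ?thesis by (simp add: sum_distrib_right)
qed

lemma norm_qinner_le:
  "norm (qinner X Y) \<le> real CARD('n) * (norm X * norm Y)" for X Y :: "quat ^ 'n"
proof -
  have "norm (qinner X Y) \<le> (\<Sum>l\<in>(UNIV :: 'n set). norm X * norm Y)"
    unfolding qinner_def
    by (intro sum_norm_le) (simp add: norm_mult_quat mult_mono Finite_Cartesian_Product.norm_nth_le)
  then show ?thesis by simp
qed

lemma bdd_above_qopnorm: "bdd_above ((\<lambda>X. norm (A *v X)) ` sphere 0 1)"
  for A :: "quat ^ 'n ^ 'n"
proof (rule bdd_aboveI2)
  fix X :: "quat ^ 'n" assume "X \<in> sphere 0 1"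
  then show "norm (A *v X) \<le> (\<Sum>i\<in>UNIV. \<Sum>j\<in>UNIV. norm (A $ i $ j))"
    using norm_qmatvec_le [of A X] by simp
qed

lemma qnum_range_nonempty: "qnum_range A \<noteq> {}"
  using qsphere_nonempty by (fastforce simp: qnum_range_def)

lemma bdd_above_qnum_range: "bdd_above (norm ` qnum_range A)"
  for A :: "quat ^ 'n ^ 'n"
proof (rule bdd_aboveI2)
  fix q assume "q \<in> qnum_range A"
  then obtain X where q: "q = qinner X (A *v X)" and X: "norm X = 1"
    by (auto simp: qnum_range_def)
  have "norm q \<le> real CARD('n) * norm (A *v X)"
    using norm_qinner_le [of X "A *v X"] by (simp add: q X)
  also have "\<dots> \<le> real CARD('n) * (\<Sum>i\<in>UNIV. \<Sum>j\<in>UNIV. norm (A $ i $ j))"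
    using norm_qmatvec_le [of A X] by (intro mult_left_mono) (simp_all add: X)
  finally show "norm q \<le> real CARD('n) * (\<Sum>i\<in>UNIV. \<Sum>j\<in>UNIV. norm (A $ i $ j))" .
qed

end

(* Real homogeneity turns the numerical radius w(B) into the bound |<X, B X>| <= w(B) |X|^2 for
   every vector X. Applied to the vector A* X it gives (1), because <X, A B A* X> = <A* X, B A* X>
   and |A* X| <= |A| |X|; a self-adjoint idempotent has norm at most 1. Applied to the two halves
   of X = (Y, Z) it gives the upper bound in (2), because the quadratic form of the block matrix is
   <Y, A Y> + <Z, B Z>; the vectors (Y, 0) and (0, Z) give the lower bound. *)
theory Submission
  imports Defs
begin

section \<open>The quaternionic inner product and adjoints\<close>

lemma qcnj_0 [simp]: "qcnj 0 = 0"
  by (simp add: quat_eq_iff)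

lemma qcnj_add: "qcnj (x + y) = qcnj x + qcnj y"
  by (simp add: quat_eq_iff)

lemma qcnj_scaleR: "qcnj (r *\<^sub>R x) = r *\<^sub>R qcnj x"
  by (simp add: quat_eq_iff)

lemma qcnj_qcnj [simp]: "qcnj (qcnj x) = x"
  by (simp add: quat_eq_iff)

lemma qcnj_sum: "qcnj (\<Sum>i\<in>I. f i) = (\<Sum>i\<in>I. qcnj (f i))"
  by (induction I rule: infinite_finite_induct) (simp_all add: qcnj_add)

lemma qre_sum: "qre (\<Sum>i\<in>I. f i) = (\<Sum>i\<in>I. qre (f i))"
  by (induction I rule: infinite_finite_induct) simp_all

text \<open>Gives access to the library's real Cauchy-Schwarz inequality, which is enough for the
  norm bounds on adjoints and projections below.\<close>

lemma qre_qinner: "qre (qinner X Y) = X \<bullet> Y"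
  by (simp add: qinner_def qre_sum inner_vec_def inner_quat_def)

lemma qinner_scaleR: "qinner (r *\<^sub>R X) (s *\<^sub>R Y) = (r * s) *\<^sub>R qinner X Y"
  by (simp add: qinner_def qcnj_scaleR scaleR_sum_right mult.commute)

lemma qmatvec_scaleR: "A *v (r *\<^sub>R X) = r *\<^sub>R (A *v X)" for A :: "quat ^ 'n ^ 'm"
  by (simp add: vec_eq_iff matrix_vector_mult_def scaleR_sum_right)

text \<open>Swap the two summations; since \<open>qcnj\<close> reverses products, no factors have to
  commute.\<close>

lemma qinner_qadjoint: "qinner X (A *v Y) = qinner (qadjoint A *v X) Y"
proof -
  have "qinner X (A *v Y) = (\<Sum>i\<in>UNIV. \<Sum>j\<in>UNIV. qcnj (X $ i) * (A $ i $ j * Y $ j))"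
    by (simp add: qinner_def matrix_vector_mult_def sum_distrib_left)
  also have "\<dots> = (\<Sum>j\<in>UNIV. \<Sum>i\<in>UNIV. qcnj (X $ i) * (A $ i $ j * Y $ j))"
    by (rule sum.swap)
  also have "\<dots> = qinner (qadjoint A *v X) Y"
    by (simp add: qinner_def matrix_vector_mult_def qadjoint_def qcnj_sum qcnj_mult
        sum_distrib_right mult.assoc)
  finally show ?thesis .
qed

lemma inner_qadjoint: "X \<bullet> (A *v Y) = (qadjoint A *v X) \<bullet> Y"
  using qinner_qadjoint [of X A Y] by (metis qre_qinner)


section \<open>Operator norm and numerical radius\<close>

lemma scaleR_unit_vector:
  fixes X :: "quat ^ 'n"
  obtains U where "norm U = 1" "X = norm X *\<^sub>R U"
proof (cases "X = 0")
  case True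
  obtain U :: "quat ^ 'n" where "norm U = 1"
    using qsphere_nonempty by fastforce
  with True show thesis by (intro that [of U]) simp_all
next
  case False
  then show thesis by (intro that [of "X /\<^sub>R norm X"]) simp_all
qed

lemma norm_qmatvec_le_qopnorm: "norm (A *v X) \<le> qopnorm A * norm X"
proof -
  obtain U where U: "norm U = 1" "X = norm X *\<^sub>R U"
    by (rule scaleR_unit_vector)
  have "norm (A *v U) \<le> qopnorm A"
    unfolding qopnorm_def using U(1) by (intro cSUP_upper bdd_above_qopnorm) simp
  moreover have "norm (A *v X) = norm X * norm (A *v U)"
    by (subst U(2)) (simp add: qmatvec_scaleR)
  ultimately show ?thesis
    by (simp add: mult.commute [of "qopnorm A"] mult_left_mono)
qed

lemma qopnorm_le:
  assumes "\<And>X. norm X = 1 \<Longrightarrow> norm (A *v X) \<le> c"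
  shows "qopnorm A \<le> c"
  unfolding qopnorm_def using assms by (intro cSUP_least qsphere_nonempty) simp

text \<open>Needs a unit vector to exist: the norm of its image lies between 0 and the
  supremum.\<close>

lemma qopnorm_nonneg: "0 \<le> qopnorm A"
proof -
  obtain U :: "quat ^ 'a" where "norm U = 1"
    using qsphere_nonempty by fastforce
  then show ?thesis
    using order_trans [OF norm_ge_zero norm_qmatvec_le_qopnorm [of A U]] by simp
qed

text \<open>With Y the adjoint image of X, |Y|^2 = X \<bullet> A Y \<le> |X| |A| |Y|, and one factor
  |Y| cancels.\<close>

lemma norm_qadjoint_le_qopnorm: "norm (qadjoint A *v X) \<le> qopnorm A * norm X"
proof -
  let ?Y = "qadjoint A *v X"
  have "norm ?Y * norm ?Y = X \<bullet> (A *v ?Y)"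
    by (simp add: inner_qadjoint flip: power2_eq_square power2_norm_eq_inner)
  also have "\<dots> \<le> norm X * norm (A *v ?Y)"
    by (rule norm_cauchy_schwarz)
  also have "\<dots> \<le> norm X * (qopnorm A * norm ?Y)"
    by (intro mult_left_mono norm_qmatvec_le_qopnorm) simp
  finally have "norm ?Y * norm ?Y \<le> (qopnorm A * norm X) * norm ?Y"
    by (simp add: mult_ac)
  then show ?thesis
    \<comment> \<open>If Y = 0 there is nothing to cancel, and the bound holds because its right
      side is nonnegative.\<close>
    by (cases "norm ?Y = 0") (simp_all add: qopnorm_nonneg)
qed

text \<open>For a unit vector X, |P X|^2 = X \<bullet> P P X = X \<bullet> P X \<le> |P X|.\<close>

lemma qopnorm_projection_le_1:
  assumes "qadjoint P = P" "P ** P = P"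
  shows "qopnorm P \<le> 1"
proof (rule qopnorm_le)
  fix X :: "quat ^ 'a" assume X: "norm X = 1"
  have "norm (P *v X) * norm (P *v X) = X \<bullet> (P *v (P *v X))"
    by (simp add: inner_qadjoint assms flip: power2_eq_square power2_norm_eq_inner)
  also have "\<dots> = X \<bullet> (P *v X)"
    by (simp add: matrix_vector_mul_assoc assms)
  also have "\<dots> \<le> norm (P *v X)"
    using norm_cauchy_schwarz [of X "P *v X"] X by simp
  finally show "norm (P *v X) \<le> 1"
    by (cases "norm (P *v X) = 0") simp_all
qed

lemma norm_qinner_le_qnum_radius: "norm (qinner X (A *v X)) \<le> qnum_radius A * (norm X)\<^sup>2"
proof -
  obtain U where U: "norm U = 1" "X = norm X *\<^sub>R U"
    by (rule scaleR_unit_vector)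
  have "norm (qinner U (A *v U)) \<le> qnum_radius A"
    unfolding qnum_radius_def using U(1)
    by (intro cSUP_upper bdd_above_qnum_range) (auto simp: qnum_range_def)
  moreover have "norm (qinner X (A *v X)) = norm (qinner U (A *v U)) * (norm X)\<^sup>2"
    \<comment> \<open>Only the two vector arguments are rewritten; the \<open>X\<close> in the
      factor \<open>norm X\<close> has to stay.\<close>
    by (subst (1 2) U(2)) (simp add: qmatvec_scaleR qinner_scaleR power2_eq_square)
  ultimately show ?thesis
    by (simp add: mult_right_mono)
qed

lemma qnum_radius_le:
  assumes "\<And>X. norm X = 1 \<Longrightarrow> norm (qinner X (A *v X)) \<le> c"
  shows "qnum_radius A \<le> c"
  unfolding qnum_radius_def using assms
  by (intro cSUP_least qnum_range_nonempty) (auto simp: qnum_range_def)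

lemma qnum_radius_nonneg: "0 \<le> qnum_radius A"
proof -
  obtain U :: "quat ^ 'a" where "norm U = 1"
    using qsphere_nonempty by fastforce
  then show ?thesis
    using order_trans [OF norm_ge_zero norm_qinner_le_qnum_radius [of U A]] by simp
qed

lemma qnum_radius_congruence_le:
  "qnum_radius (A ** B ** qadjoint A) \<le> (qopnorm A)\<^sup>2 * qnum_radius B"
proof (rule qnum_radius_le)
  fix X :: "quat ^ 'a" assume X: "norm X = 1"
  let ?Y = "qadjoint A *v X"
  \<comment> \<open>Both sides reach the same form once every matrix has been moved into the left
    argument.\<close>
  have "qinner X ((A ** B ** qadjoint A) *v X) = qinner ?Y (B *v ?Y)"
    by (simp add: qinner_qadjoint flip: matrix_vector_mul_assoc)
  then have "norm (qinner X ((A ** B ** qadjoint A) *v X)) \<le> qnum_radius B * (norm ?Y)\<^sup>2"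
    using norm_qinner_le_qnum_radius by simp
  also have "\<dots> \<le> qnum_radius B * (qopnorm A)\<^sup>2"
    using norm_qadjoint_le_qopnorm [of A X] X
    by (intro mult_left_mono power_mono qnum_radius_nonneg) simp_all
  finally show "norm (qinner X ((A ** B ** qadjoint A) *v X)) \<le> (qopnorm A)\<^sup>2 * qnum_radius B"
    by (simp add: mult.commute)
qed

text \<open>Self-adjointness makes \<open>P ** B ** P\<close> a congruence of \<open>B\<close> by
  \<open>P\<close>, and the factor |P|^2 is at most 1.\<close>

lemma qnum_radius_compression_le:
  assumes "qadjoint P = P" "P ** P = P"
  shows "qnum_radius (P ** B ** P) \<le> qnum_radius B"
proof -
  have "qnum_radius (P ** B ** P) \<le> (qopnorm P)\<^sup>2 * qnum_radius B"
    using qnum_radius_congruence_le [of P B] assms by simp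
  also have "\<dots> \<le> 1 * qnum_radius B"
    using qopnorm_projection_le_1 [OF assms]
    by (intro mult_right_mono qnum_radius_nonneg) (simp add: qopnorm_nonneg power_le_one)
  finally show ?thesis by simp
qed


section \<open>Block diagonal matrices\<close>

definition vec_join :: "'a ^ 'm \<Rightarrow> 'a ^ 'n \<Rightarrow> 'a ^ ('m + 'n)"
  where "vec_join Y Z = (\<chi> i. case i of Inl k \<Rightarrow> Y $ k | Inr k \<Rightarrow> Z $ k)"

lemma vec_join_nth [simp]:
  "vec_join Y Z $ Inl k = Y $ k" "vec_join Y Z $ Inr l = Z $ l"
  by (simp_all add: vec_join_def)

lemma vec_join_cases:
  obtains Y Z where "X = vec_join Y Z"
proof
  show "X = vec_join (\<chi> k. X $ Inl k) (\<chi> k. X $ Inr k)"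
    by (simp add: vec_join_def vec_eq_iff split: sum.split)
qed

lemma sum_UNIV_Plus:
  "(\<Sum>i\<in>UNIV. f i) = (\<Sum>k\<in>UNIV. f (Inl k)) + (\<Sum>l\<in>UNIV. f (Inr l))"
  for f :: "'m::finite + 'n::finite \<Rightarrow> 'a::comm_monoid_add"
  by (simp add: sum.Plus flip: UNIV_Plus_UNIV)

lemma qinner_vec_join: "qinner (vec_join Y Z) (vec_join Y' Z') = qinner Y Y' + qinner Z Z'"
  by (simp add: qinner_def sum_UNIV_Plus)

text \<open>Pythagoras for the two orthogonal halves of a vector.\<close>

lemma norm_vec_join: "(norm (vec_join Y Z))\<^sup>2 = (norm Y)\<^sup>2 + (norm Z)\<^sup>2"
  for Y :: "'a::real_inner ^ 'm"
  by (simp add: power2_norm_eq_inner inner_vec_def sum_UNIV_Plus)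

lemma qblock_diag_vec_join: "qblock_diag A B *v vec_join Y Z = vec_join (A *v Y) (B *v Z)"
  by (simp add: vec_eq_iff matrix_vector_mult_def qblock_diag_def sum_UNIV_Plus vec_join_def
      split: sum.split)

lemma qinner_qblock_diag:
  "qinner (vec_join Y Z) (qblock_diag A B *v vec_join Y Z) = qinner Y (A *v Y) + qinner Z (B *v Z)"
  by (simp add: qblock_diag_vec_join qinner_vec_join)

lemma qinner_0_left [simp]: "qinner 0 X = 0"
  by (simp add: qinner_def)

lemma qnum_radius_qblock_diag:
  "qnum_radius (qblock_diag A B) = max (qnum_radius A) (qnum_radius B)"
proof (rule antisym)
  let ?w = "max (qnum_radius A) (qnum_radius B)"
  show "qnum_radius (qblock_diag A B) \<le> ?w"
  proof (rule qnum_radius_le)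
    fix X :: "quat ^ ('a + 'a)" assume X: "norm X = 1"
    obtain Y Z where YZ: "X = vec_join Y Z"
      by (rule vec_join_cases)
    have "norm (qinner X (qblock_diag A B *v X))
        \<le> norm (qinner Y (A *v Y)) + norm (qinner Z (B *v Z))"
      by (simp add: YZ qinner_qblock_diag norm_triangle_ineq)
    also have "\<dots> \<le> qnum_radius A * (norm Y)\<^sup>2 + qnum_radius B * (norm Z)\<^sup>2"
      by (intro add_mono norm_qinner_le_qnum_radius)
    also have "\<dots> \<le> ?w * (norm Y)\<^sup>2 + ?w * (norm Z)\<^sup>2"
      by (intro add_mono mult_right_mono) simp_all
    \<comment> \<open>The weights |Y|^2 and |Z|^2 add up to |X|^2 = 1.\<close>
    also have "\<dots> = ?w"
      using norm_vec_join [of Y Z] X by (simp add: YZ flip: distrib_left)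
    finally show "norm (qinner X (qblock_diag A B *v X)) \<le> ?w" .
  qed
  \<comment> \<open>Padding with a zero half keeps the norm equal to 1, and the quadratic form of
    the other block vanishes there.\<close>
  have "norm (qinner Y (A *v Y)) \<le> qnum_radius (qblock_diag A B)" if "norm Y = 1" for Y
    using norm_qinner_le_qnum_radius [of "vec_join Y 0" "qblock_diag A B"] that
    by (simp add: qinner_qblock_diag norm_vec_join)
  moreover have "norm (qinner Z (B *v Z)) \<le> qnum_radius (qblock_diag A B)" if "norm Z = 1" for Z
    using norm_qinner_le_qnum_radius [of "vec_join 0 Z" "qblock_diag A B"] that
    by (simp add: qinner_qblock_diag norm_vec_join)
  ultimately show "?w \<le> qnum_radius (qblock_diag A B)"
    by (simp add: qnum_radius_le)
qed

theorem theorem3p5: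
  fixes A B :: "quat ^ 'n ^ 'n"
  shows "qnum_radius (A ** B ** qadjoint A) \<le> (qopnorm A)\<^sup>2 * qnum_radius B
    \<and> (\<forall>P :: quat ^ 'n ^ 'n. qadjoint P = P \<and> P ** P = P
          \<longrightarrow> qnum_radius (P ** B ** P) \<le> qnum_radius B)
    \<and> qnum_radius (qblock_diag A B) = max (qnum_radius A) (qnum_radius B)"
  by (simp add: qnum_radius_congruence_le qnum_radius_compression_le qnum_radius_qblock_diag)

end
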